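(* Let $G=(V,E)$ be a finite connected subgraph of $\mathbb{L}$. There exists a splitting set $Q$ of plaquettes such that: (i) $V\subseteq\mathrm{ins}([Q])$; (ii) every plaquette in $Q$ is dual to some edge of $\mathbb{E}$ having exactly one endvertex in $V$; (iii) if $W$ is a connected set of vertices such that $V\cap W=\varnothing$, and there exists an infinite path on $\mathbb{L}$ starting in $W$ which uses no vertices in $V$, then $W\subseteq\mathrm{out}([Q])$.
   Context: $\mathbb{L}=(\mathbb{Z}^3,\mathbb{E})$ is the cubic lattice: there is an edge $\langle x,y\rangle$ iff $\sum_i|x_i-y_i|=1$. Graphs are non-empty; paths have distinct vertices. A set of vertices is connected if it induces a connected subgraph of $\mathbb{L}$. A plaquette is a closed unit square in $\mathbb{R}^3$ with corners in $\mathbb{Z}^3+(\frac12,\frac12,\frac12)$. For an edge $\langle x,y\rangle\in\mathbb{E}$, its dual plaquette $h(\langle x,y\rangle)$ is the unique plaquette through the middle of which the segment $xy$ passes (and the plaquette is dual to the edge). Distinct plaquettes $h_1,h_2$ are 1-connected if $h_1\cap h_2$ is homeomorphic to $[0,1]$; a set of plaquettes is 1-connected if it is connected as a graph with this adjacency relation. For a set $H$ of plaquettes, $[H]\subseteq\mathbb{R}^3$ is the union of the plaquettes in $H$. For $T\subseteq\mathbb{R}^3$, $\mathrm{ins}(T)$ is the union of all bounded connected components of $\mathbb{R}^3\setminus T$, and $\mathrm{out}(T)$ is the union of all unbounded connected components of $\mathbb{R}^3\setminus T$ (topological connectedness). A finite set $H$ of plaquettes is a splitting set if $H$ is 1-connected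 and $\mathbb{R}^3\setminus[H]$ has at least one bounded connected component. *)

theory Defs
  imports "HOL-Analysis.Analysis"
begin

text \<open>Graphs are given by a vertex set and an adjacency relation.\<close>

definition graph_path :: "'a set \<Rightarrow> ('a \<Rightarrow> 'a \<Rightarrow> bool) \<Rightarrow> 'a list \<Rightarrow> bool" where
  "graph_path V R xs \<longleftrightarrow> xs \<noteq> [] \<and> distinct xs \<and> set xs \<subseteq> V \<and> successively R xs"

definition connected_graph :: "'a set \<Rightarrow> ('a \<Rightarrow> 'a \<Rightarrow> bool) \<Rightarrow> bool" where
  "connected_graph V R \<longleftrightarrow> V \<noteq> {} \<and>
     (\<forall>x\<in>V. \<forall>y\<in>V. \<exists>xs. graph_path V R xs \<and> hd xs = x \<and> last xs = y)"

type_synonym vertex = "int ^ 3"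

definition lattice_edges :: "vertex set set" where
  "lattice_edges = {{x, y} | x y. (\<Sum>i\<in>UNIV. \<bar>x $ i - y $ i\<bar>) = 1}"

definition lattice_subgraph :: "vertex set \<Rightarrow> vertex set set \<Rightarrow> bool" where
  "lattice_subgraph V E \<longleftrightarrow> V \<noteq> {} \<and> E \<subseteq> lattice_edges \<and> \<Union>E \<subseteq> V"

text \<open>The induced subgraph on \<open>W\<close> is connected; paths are confined to \<open>W\<close> by
  \<^const>\<open>graph_path\<close>.\<close>

definition connected_vertices :: "vertex set \<Rightarrow> bool" where
  "connected_vertices W \<longleftrightarrow> connected_graph W (\<lambda>x y. {x, y} \<in> lattice_edges)"

definition infinite_lattice_path :: "(nat \<Rightarrow> vertex) \<Rightarrow> bool" where
  "infinite_lattice_path p \<longleftrightarrow> inj p \<and> (\<forall>n. {p n, p (Suc n)} \<in> lattice_edges)"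

definition pt :: "vertex \<Rightarrow> real ^ 3" where
  "pt x = (\<chi> i. real_of_int (x $ i))"

definition shifted_lattice :: "(real ^ 3) set" where
  "shifted_lattice = range (\<lambda>x. pt x + (\<chi> i. 1 / 2))"

text \<open>\<open>h\<close> is a closed unit square with corners in the shifted lattice, and \<open>m\<close> is its middle.\<close>

definition plaquette_with_middle :: "(real ^ 3) set \<Rightarrow> real ^ 3 \<Rightarrow> bool" where
  "plaquette_with_middle h m \<longleftrightarrow>
     (\<exists>a u v. norm u = 1 \<and> norm v = 1 \<and> u \<bullet> v = 0 \<and>
        {a, a + u, a + v, a + u + v} \<subseteq> shifted_lattice \<and>
        h = convex hull {a, a + u, a + v, a + u + v} \<and>
        m = a + (1 / 2) *\<^sub>R (u + v))"

definition plaquettes :: "(real ^ 3) set set" where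
  "plaquettes = {h. \<exists>m. plaquette_with_middle h m}"

text \<open>For an edge \<open>{x, y}\<close>, the convex hull below is the closed segment from \<open>x\<close> to \<open>y\<close>.
  The description is only meaningful for members of \<^const>\<open>lattice_edges\<close>: there the middle
  has to be the midpoint of the segment (it has exactly one non-integer coordinate),
  and this determines the plaquette.\<close>

definition dual_plaquette :: "vertex set \<Rightarrow> (real ^ 3) set" where
  "dual_plaquette e = (THE h. \<exists>m. plaquette_with_middle h m \<and> m \<in> convex hull (pt ` e))"

definition plaquette_adj :: "(real ^ 3) set \<Rightarrow> (real ^ 3) set \<Rightarrow> bool" where
  "plaquette_adj h1 h2 \<longleftrightarrow> h1 \<noteq> h2 \<and> (h1 \<inter> h2) homeomorphic {0..1::real}"

definition one_connected :: "(real ^ 3) set set \<Rightarrow> bool" where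
  "one_connected H \<longleftrightarrow> connected_graph H plaquette_adj"

definition splitting_set :: "(real ^ 3) set set \<Rightarrow> bool" where
  "splitting_set H \<longleftrightarrow> finite H \<and> H \<subseteq> plaquettes \<and> one_connected H \<and>
     (\<exists>C\<in>components (- \<Union>H). bounded C)"

lemma component_eq_connected_component_set:
  assumes "C \<in> components S" "x \<in> C"
  shows "C = connected_component_set S x" "x \<in> S"
proof -
  obtain y where y: "C = connected_component_set S y"
    using assms(1) by (auto simp: components_iff)
  show "C = connected_component_set S x"
    using assms(2) unfolding y by (rule connected_component_eq[symmetric])
  show "x \<in> S"
    using assms in_components_subset by blast
qed

lemma inside_eq_Union_bounded_components:
  "inside T = \<Union>{C \<in> components (- T). bounded C}" (is "_ = ?U")
proof
  show "inside T \<subseteq> ?U"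
    by (auto simp: inside_def components_iff intro!: exI[of _ "connected_component_set (- T) _"])
  show "?U \<subseteq> inside T"
    using component_eq_connected_component_set[of _ "- T"] by (fastforce simp: inside_def)
qed

lemma outside_eq_Union_unbounded_components:
  "outside T = \<Union>{C \<in> components (- T). \<not> bounded C}" (is "_ = ?U")
proof
  show "outside T \<subseteq> ?U"
  proof
    fix x assume "x \<in> outside T"
    then have "x \<in> - T" "\<not> bounded (connected_component_set (- T) x)"
      by (auto simp: outside_def inside_def)
    then show "x \<in> ?U"
      by (auto simp: components_iff intro!: exI[of _ "connected_component_set (- T) x"])
  qed
  show "?U \<subseteq> outside T"
    using component_eq_connected_component_set[of _ "- T"] by (fastforce simp: outside)
qed

end

theory Submission imports Defs begin

text \<open>
  The splitting set is the outer boundary of \<open>V\<close>. Let \<open>U\<close> be the infinite component of the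
  lattice minus \<open>V\<close> and let \<open>A\<close> be its complement, that is, \<open>V\<close> with its holes filled in.
  Then \<open>A\<close> is finite, both \<open>A\<close> and \<open>U\<close> are connected, and every edge between them has its
  end in \<open>A\<close> already in \<open>V\<close>. The set \<open>Q\<close> consists of the plaquettes dual to these edges
  (\<open>boundary A\<close> below).

  The main point is that \<open>Q\<close> is 1-connected (\<open>one_connected_boundary\<close>). The proof is
  cohomological. The coboundary of the indicator function of \<open>A\<close> is a 1-cochain \<open>D\<close> supported
  on the edges that leave \<open>A\<close>. Fix a plaquette \<open>h\<close> in \<open>Q\<close> and let \<open>f\<close> be \<open>D\<close> restricted to the
  edges whose plaquettes can be reached from \<open>h\<close> inside \<open>Q\<close>. Any two edges of a lattice square
  have 1-connected dual plaquettes (\<open>square_edges_adj\<close>), so on each square \<open>f\<close> is either \<open>D\<close> or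
  zero, and hence \<open>f\<close> is closed. By the discrete Poincare lemma \<open>f\<close> is the coboundary of some
  \<open>g\<close>. As \<open>f\<close> vanishes on edges within \<open>A\<close> and on edges within its complement, and both are
  connected, \<open>g\<close> takes just one value on each of them. Therefore \<open>f\<close> is a constant multiple of
  \<open>D\<close>; the constant is nonzero because \<open>f\<close> does not vanish at \<open>h\<close>, so every plaquette of \<open>Q\<close>
  is reached.

  The separation properties come from the unit cubes about the vertices of \<open>A\<close>. The frontier
  of their union lies in the union of \<open>Q\<close>, so a component of the complement that meets \<open>A\<close> is
  trapped in a bounded set (\<open>pt_inside_boundary\<close>). On the other hand a lattice segment
  meets no plaquette but its own dual, so all of \<open>U\<close> lies in one component, which is
  unbounded (\<open>pt_outside_boundary\<close>).
\<close>

section \<open>Connected graphs and confined walks\<close>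

text \<open>Joined by a walk inside \<open>S\<close>. A vertex is linked to itself even when it lies outside \<open>S\<close>;
  every longer walk has both ends in \<open>S\<close>.\<close>

definition linked :: "'a set \<Rightarrow> ('a \<Rightarrow> 'a \<Rightarrow> bool) \<Rightarrow> 'a \<Rightarrow> 'a \<Rightarrow> bool" where
  "linked S R = (\<lambda>a b. a \<in> S \<and> b \<in> S \<and> R a b)\<^sup>*\<^sup>*"

lemma linked_refl [simp]: "linked S R x x"
  by (simp add: linked_def)

lemma linked_trans [trans]: "linked S R x y \<Longrightarrow> linked S R y z \<Longrightarrow> linked S R x z"
  unfolding linked_def by (rule rtranclp_trans)

lemma linked_step: "x \<in> S \<Longrightarrow> y \<in> S \<Longrightarrow> R x y \<Longrightarrow> linked S R x y"
  by (simp add: linked_def r_into_rtranclp)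

lemma linked_mono:
  assumes "linked S R x y" "S \<subseteq> S'" "\<And>a b. R a b \<Longrightarrow> R' a b"
  shows "linked S' R' x y"
proof -
  have "(\<lambda>a b. a \<in> S \<and> b \<in> S \<and> R a b) \<le> (\<lambda>a b. a \<in> S' \<and> b \<in> S' \<and> R' a b)"
    using assms(2,3) by auto
  from rtranclp_mono[OF this] show ?thesis
    using assms(1) unfolding linked_def by blast
qed

lemma linked_sym:
  assumes "linked S R x y" "\<And>a b. R a b \<Longrightarrow> R b a"
  shows "linked S R y x"
proof -
  have "symp (\<lambda>a b. a \<in> S \<and> b \<in> S \<and> R a b)\<^sup>*\<^sup>*"
    by (rule symp_rtranclp) (auto simp: symp_def assms(2))
  then show ?thesis
    using assms(1) unfolding linked_def by (blast dest: sympD)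
qed

text \<open>Functions constant along edges are used to transport facts along walks.\<close>

lemma linked_const:
  assumes "linked S R x y"
    and "\<And>a b. a \<in> S \<Longrightarrow> b \<in> S \<Longrightarrow> R a b \<Longrightarrow> g a = g b"
  shows "g x = g y"
  using assms(1) unfolding linked_def by (induction rule: rtranclp_induct) (simp_all add: assms(2))

lemma path_imp_linked:
  assumes "graph_path S R xs"
  shows "linked S R (hd xs) (last xs)"
  using assms
proof (induction xs rule: induct_list012)
  case (3 x y zs)
  then have "linked S R x y"
    by (intro linked_step) (auto simp: graph_path_def)
  also have "linked S R y (last (y # zs))"
    using 3 by (auto simp: graph_path_def)
  finally show ?case by simp
qed (auto simp: graph_path_def)

text \<open>A walk becomes a path by cutting out, at each new first vertex, the loop that returns to it.\<close>

lemma linked_imp_path: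
  assumes "linked S R x y" "y \<in> S"
  shows "\<exists>xs. graph_path S R xs \<and> hd xs = x \<and> last xs = y"
  using assms(1) unfolding linked_def
proof (induction rule: converse_rtranclp_induct)
  case base
  then show ?case using assms(2) by (intro exI[of _ "[y]"]) (auto simp: graph_path_def)
next
  case (step x z)
  then obtain xs where xs: "graph_path S R xs" "hd xs = z" "last xs = y" by auto
  show ?case
  proof (cases "x \<in> set xs")
    case True
    then obtain as bs where "xs = as @ x # bs" by (meson split_list)
    then show ?thesis
      using xs by (intro exI[of _ "x # bs"]) (auto simp: graph_path_def successively_append_iff)
  next
    case False
    then show ?thesis
      using xs step by (intro exI[of _ "x # xs"]) (auto simp: graph_path_def successively_Cons)
  qed
qed

lemma connected_graph_iff_linked:
  "connected_graph S R \<longleftrightarrow> S \<noteq> {} \<and> (\<forall>x\<in>S. \<forall>y\<in>S. linked S R x y)"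
proof -
  have "(\<exists>xs. graph_path S R xs \<and> hd xs = x \<and> last xs = y) \<longleftrightarrow> linked S R x y" if "y \<in> S" for x y
    using linked_imp_path[OF _ that] path_imp_linked[of S R] by blast
  then show ?thesis
    unfolding connected_graph_def by simp
qed

section \<open>Lattice geometry\<close>

abbreviation adj :: "vertex \<Rightarrow> vertex \<Rightarrow> bool" where
  "adj x y \<equiv> {x, y} \<in> lattice_edges"

lemma adj_sym: "adj x y \<Longrightarrow> adj y x"
  by (simp add: insert_commute)

lemma other_index:
  fixes i j :: 3
  assumes "i \<noteq> j"
  obtains k where "k \<noteq> i" "k \<noteq> j" "\<And>l. l = i \<or> l = j \<or> l = k"
proof -
  have ex_3: "(\<exists>x::3. P x) \<longleftrightarrow> P 1 \<or> P 2 \<or> P 3" for P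
    by (metis exhaust_3)
  have "\<forall>i j :: 3. i \<noteq> j \<longrightarrow> (\<exists>k. k \<noteq> i \<and> k \<noteq> j \<and> (\<forall>l. l = i \<or> l = j \<or> l = k))"
    by (simp add: forall_3 ex_3)
  with assms show thesis using that by blast
qed

text \<open>An integer vector whose absolute coordinates sum to one has a single nonzero entry, which makes
  every lattice edge a translate of a coordinate direction.\<close>

lemma unit_int_vector:
  fixes w :: "int ^ 3"
  shows "(\<Sum>i\<in>UNIV. \<bar>w $ i\<bar>) = 1 \<longleftrightarrow> (\<exists>d. w = axis d 1 \<or> w = - axis d 1)"
proof
  assume "(\<Sum>i\<in>UNIV. \<bar>w $ i\<bar>) = 1"
  then have *: "\<bar>w $ 1\<bar> + \<bar>w $ 2\<bar> + \<bar>w $ 3\<bar> = 1" by (simp add: sum_3)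
  then consider "w $ 1 \<noteq> 0" "w $ 2 = 0" "w $ 3 = 0"
    | "w $ 1 = 0" "w $ 2 \<noteq> 0" "w $ 3 = 0"
    | "w $ 1 = 0" "w $ 2 = 0" "w $ 3 \<noteq> 0"
    by linarith
  then show "\<exists>d. w = axis d 1 \<or> w = - axis d 1"
  proof cases
    case 1
    then have "w $ 1 = 1 \<or> w $ 1 = -1" using * by auto
    with 1 show ?thesis by (intro exI[of _ 1]) (auto simp: vec_eq_iff forall_3 axis_def)
  next
    case 2
    then have "w $ 2 = 1 \<or> w $ 2 = -1" using * by auto
    with 2 show ?thesis by (intro exI[of _ 2]) (auto simp: vec_eq_iff forall_3 axis_def)
  next
    case 3
    then have "w $ 3 = 1 \<or> w $ 3 = -1" using * by auto
    with 3 show ?thesis by (intro exI[of _ 3]) (auto simp: vec_eq_iff forall_3 axis_def)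
  qed
next
  assume "\<exists>d. w = axis d 1 \<or> w = - axis d 1"
  then obtain d where "w = axis d 1 \<or> w = - axis d 1" ..
  then have "(\<Sum>i\<in>UNIV. \<bar>w $ i\<bar>) = (\<Sum>i\<in>UNIV. if i = d then 1 else 0)"
    by (intro sum.cong) (auto simp: axis_def)
  then show "(\<Sum>i\<in>UNIV. \<bar>w $ i\<bar>) = 1" by simp
qed

lemma adj_iff: "adj x y \<longleftrightarrow> (\<exists>d. y = x + axis d 1 \<or> x = y + axis d 1)"
proof -
  have "(\<Sum>i\<in>UNIV. \<bar>a $ i - b $ i\<bar>) = 1 \<longleftrightarrow> (\<exists>d. b = a + axis d 1 \<or> a = b + axis d 1)"
    for a b :: vertex
  proof -
    have "(\<Sum>i\<in>UNIV. \<bar>a $ i - b $ i\<bar>) = (\<Sum>i\<in>UNIV. \<bar>(b - a) $ i\<bar>)"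
      by (simp add: abs_minus_commute)
    moreover have "b - a = w \<longleftrightarrow> b = a + w" "b - a = - w \<longleftrightarrow> a = b + w" for w
      by (auto simp: algebra_simps)
    ultimately show ?thesis
      by (simp only: unit_int_vector)
  qed
  then show ?thesis
    unfolding lattice_edges_def by (auto simp: doubleton_eq_iff)
qed

lemma adj_axis [simp]: "adj x (x + axis d 1)"
  by (auto simp: adj_iff)

definition upd :: "'a ^ 'n \<Rightarrow> 'n \<Rightarrow> 'a \<Rightarrow> 'a ^ 'n" where
  "upd x j t = (\<chi> k. if k = j then t else x $ k)"

lemma upd_nth [simp]: "upd x j t $ k = (if k = j then t else x $ k)"
  by (simp add: upd_def)

lemma upd_idle [simp]: "upd x j (x $ j) = x"
  by (simp add: vec_eq_iff)

lemma linked_line: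
  assumes "\<And>t. upd x j t \<in> S"
  shows "linked S adj (upd x j s) (upd x j t)"
proof -
  have up: "linked S adj (upd x j s) (upd x j t)" if "s \<le> t" for s t
    using that
  proof (induction t rule: int_ge_induct)
    case (step t)
    have "upd x j (t + 1) = upd x j t + axis j 1"
      by (auto simp: vec_eq_iff axis_def)
    then have "linked S adj (upd x j t) (upd x j (t + 1))"
      using assms[of t] assms[of "t + 1"] by (intro linked_step) auto
    with step show ?case by (blast intro: linked_trans)
  qed simp
  show ?thesis
    using up[of s t] linked_sym[OF up[of t s] adj_sym] by fastforce
qed

text \<open>Axis-parallel subspaces are connected: the coordinates in \<open>T\<close> are corrected one at a time, each
  along a line that stays in the subspace.\<close>

lemma linked_flat:
  fixes x y :: vertex
  assumes "finite T"
    and "\<And>y. (\<forall>k. k \<notin> T \<longrightarrow> y $ k = x $ k) \<Longrightarrow> y \<in> S"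
    and "\<forall>k. k \<notin> T \<longrightarrow> y $ k = x $ k"
  shows "linked S adj x y"
  using assms
proof (induction T arbitrary: y rule: finite_induct)
  case empty
  then have "y = x" by (simp add: vec_eq_iff)
  then show ?case by simp
next
  case (insert j T)
  have "linked S adj x (upd y j (x $ j))"
    using insert.prems by (intro insert.IH) auto
  also have "linked S adj (upd y j (x $ j)) (upd y j (y $ j))"
    using insert.prems by (intro linked_line) auto
  finally show ?case by simp
qed

text \<open>The outside of a cube is connected. A point with \<open>i\<close>-th coordinate beyond \<open>N\<close> stays outside
  while all other coordinates move to \<open>N + 1\<close>; after that another coordinate \<open>j\<close> keeps it
  outside while the \<open>i\<close>-th one moves.\<close>

lemma linked_far:
  assumes "\<And>y i. \<bar>y $ i\<bar> > N \<Longrightarrow> y \<in> S" and "\<bar>x $ i\<bar> > N" "0 \<le> N"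
  shows "linked S adj x (\<chi> k. N + 1)"
proof -
  let ?y = "upd (\<chi> k. N + 1) i (x $ i)"
  (* addition in the index type is modulo 3, so this is a different index *)
  obtain j where "j \<noteq> i"
    using that[of "i + 1"] by simp
  have "linked S adj x ?y"
  proof (rule linked_flat[where T = "- {i}"])
    fix y assume "\<forall>k. k \<notin> - {i} \<longrightarrow> y $ k = x $ k"
    then show "y \<in> S" using assms(2) by (intro assms(1)[of _ i]) simp
  qed auto
  also have "linked S adj ?y (\<chi> k. N + 1)"
  proof (rule linked_flat[where T = "{i}"])
    fix y assume "\<forall>k. k \<notin> {i} \<longrightarrow> y $ k = ?y $ k"
    then have "y $ j = N + 1" using \<open>j \<noteq> i\<close> by simp
    then show "y \<in> S" using \<open>0 \<le> N\<close> by (intro assms(1)[of _ j]) simp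
  qed auto
  finally show ?thesis .
qed

lemma finite_int_box: "finite {x :: int ^ 'n. \<forall>i. x $ i \<in> {lo i..hi i}}"
proof -
  have "{x :: int ^ 'n. \<forall>i. x $ i \<in> {lo i..hi i}} \<subseteq> vec_lambda ` (PiE UNIV (\<lambda>i. {lo i..hi i}))"
  proof
    fix x :: "int ^ 'n" assume "x \<in> {x. \<forall>i. x $ i \<in> {lo i..hi i}}"
    then show "x \<in> vec_lambda ` (PiE UNIV (\<lambda>i. {lo i..hi i}))"
      by (intro image_eqI[of _ _ "vec_nth x"]) (auto simp: vec_nth_inverse)
  qed
  then show ?thesis
    by (rule finite_subset) (intro finite_imageI finite_PiE; simp)
qed

section \<open>Discrete Poincare lemma\<close>

text \<open>The discrete line integral of \<open>h\<close> from \<open>0\<close> to \<open>t\<close>, with the usual sign for negative \<open>t\<close>.\<close>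

definition line_sum :: "(int \<Rightarrow> 'g) \<Rightarrow> int \<Rightarrow> 'g :: ab_group_add" where
  "line_sum h t = sum h {0..<t} - sum h {t..<0}"

lemma line_sum_step: "line_sum h (t + 1) = line_sum h t + h t"
proof (cases "0 \<le> t")
  case True
  then have "{0..<t + 1} = insert t {0..<t}" by auto
  with True show ?thesis by (simp add: line_sum_def)
next
  case False
  then have "{t..<0} = insert t {t + 1..<0}" by auto
  with False show ?thesis by (simp add: line_sum_def)
qed

text \<open>Induction on the set of directions in which \<open>g\<close> is already a primitive of \<open>f\<close>. To add the
  direction \<open>j\<close>, the error \<open>r\<close> of \<open>g\<close> in direction \<open>j\<close> is integrated along the lines in that
  direction. Closedness makes \<open>r\<close> invariant under shifts in the old directions, so the
  correction \<open>P\<close> does not spoil what was achieved before.\<close>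

lemma discrete_poincare_on:
  fixes f :: "int ^ 'n \<Rightarrow> 'n \<Rightarrow> 'g :: ab_group_add"
  assumes "finite S"
    and closed: "\<And>x i j. i \<noteq> j \<Longrightarrow> f x i + f (x + axis i 1) j = f x j + f (x + axis j 1) i"
  shows "\<exists>g. \<forall>x. \<forall>i\<in>S. g (x + axis i 1) - g x = f x i"
  using assms(1)
proof (induction S rule: finite_induct)
  case (insert j S)
  then obtain g where g: "\<And>x i. i \<in> S \<Longrightarrow> g (x + axis i 1) - g x = f x i" by blast
  define r where "r x = f x j - (g (x + axis j 1) - g x)" for x
  have r_inv: "r (x + axis i 1) = r x" if "i \<in> S" for x i
  proof -
    have "i \<noteq> j" using that insert by blast
    from closed[OF this, of x]
    have "f x i + f (x + axis i 1) j = f x j + f (x + axis j 1) i" .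
    then show ?thesis
      using g[OF that, of x] g[OF that, of "x + axis j 1"]
      by (simp add: r_def algebra_simps)
  qed
  define P where "P x = line_sum (\<lambda>s. r (upd x j s)) (x $ j)" for x
  have "P (x + axis j 1) - P x = r x" for x
  proof -
    have "upd (x + axis j 1) j s = upd x j s" for s
      by (auto simp: vec_eq_iff axis_def)
    then show ?thesis by (simp add: P_def axis_def line_sum_step)
  qed
  moreover have "P (x + axis i 1) - P x = 0" if "i \<in> S" for x i
  proof -
    have "i \<noteq> j" using that insert by blast
    then have "upd (x + axis i 1) j s = upd x j s + axis i 1" for s
      by (auto simp: vec_eq_iff axis_def)
    with \<open>i \<noteq> j\<close> show ?thesis by (simp add: P_def axis_def[of i] r_inv[OF that, unfolded axis_def])
  qed
  ultimately show ?case
    using g by (intro exI[of _ "\<lambda>x. g x + P x"]) (fastforce simp: r_def algebra_simps)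
qed simp

lemma discrete_poincare:
  fixes f :: "int ^ 'n \<Rightarrow> 'n \<Rightarrow> 'g :: ab_group_add"
  assumes "\<And>x i j. i \<noteq> j \<Longrightarrow> f x i + f (x + axis i 1) j = f x j + f (x + axis j 1) i"
  obtains g where "\<And>x i. g (x + axis i 1) - g x = f x i"
proof -
  have "\<exists>g. \<forall>x. \<forall>i\<in>UNIV. g (x + axis i 1) - g x = f x i"
    by (rule discrete_poincare_on) (use assms in auto)
  then show thesis using that by blast
qed

section \<open>Faces of unit cubes\<close>

definition cube :: "vertex \<Rightarrow> (real ^ 3) set" where
  "cube x = {z. \<forall>i. \<bar>z $ i - real_of_int (x $ i)\<bar> \<le> 1 / 2}"

text \<open>The face of \<open>cube x\<close> that it shares with \<open>cube (x + axis d 1)\<close>; this is a concrete form of the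
  plaquette dual to the edge between \<open>x\<close> and \<open>x + axis d 1\<close>, as shown in
  \<open>dual_plaquette_eq_face\<close> below.\<close>

definition face :: "vertex \<Rightarrow> 3 \<Rightarrow> (real ^ 3) set" where
  "face x d = {z. z $ d = real_of_int (x $ d) + 1 / 2 \<and>
     (\<forall>i. i \<noteq> d \<longrightarrow> \<bar>z $ i - real_of_int (x $ i)\<bar> \<le> 1 / 2)}"

text \<open>The plaquettes dual to the edges that leave \<open>A\<close>, in either orientation.\<close>

definition boundary :: "vertex set \<Rightarrow> (real ^ 3) set set" where
  "boundary A = {face x d | x d. (x \<in> A) \<noteq> (x + axis d 1 \<in> A)}"

lemma pt_nth [simp]: "pt x $ i = real_of_int (x $ i)"
  by (simp add: pt_def)

text \<open>Comparing coordinates with this lemma tells the normal direction of a face from the others.\<close>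

lemma half_integer: "real_of_int a \<noteq> real_of_int b + 1 / 2"
proof (cases "a \<le> b")
  case False
  then have "real_of_int b + 1 \<le> real_of_int a" by linarith
  then show ?thesis by linarith
qed linarith

lemma mem_face_iff:
  "z \<in> face x d \<longleftrightarrow> z $ d = real_of_int (x $ d) + 1 / 2 \<and>
     (\<forall>i. i \<noteq> d \<longrightarrow> real_of_int (x $ i) - 1 / 2 \<le> z $ i \<and> z $ i \<le> real_of_int (x $ i) + 1 / 2)"
proof -
  have "\<bar>a - b\<bar> \<le> 1 / 2 \<longleftrightarrow> b - 1 / 2 \<le> a \<and> a \<le> b + 1 / 2" for a b :: real
    by linarith
  then show ?thesis
    unfolding face_def mem_Collect_eq by simp
qed

lemma pt_notin_face: "pt x \<notin> face y d"
proof
  assume "pt x \<in> face y d"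
  then have "real_of_int (x $ d) = real_of_int (y $ d) + 1 / 2" by (simp add: face_def)
  then show False using half_integer by blast
qed

lemma face_center: "pt x + (1 / 2) *\<^sub>R axis d 1 \<in> face x d"
  by (simp add: face_def axis_def)

text \<open>A face is recovered from its center: the center has one half-integer coordinate, which gives the
  direction, and rounding it down gives the vertex.\<close>

lemma face_inj:
  assumes "face x d = face y e"
  shows "x = y \<and> d = e"
proof -
  have *: "pt x + (1 / 2) *\<^sub>R axis d 1 \<in> face y e"
    using face_center[of x d] assms by simp
  have "d = e"
  proof (rule ccontr)
    assume "d \<noteq> e"
    with * have "real_of_int (x $ e) = real_of_int (y $ e) + 1 / 2"
      by (simp add: face_def axis_def)
    then show False using half_integer by blast
  qed
  moreover have "x $ i = y $ i" for i
  proof (cases "i = d")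
    case True
    with * \<open>d = e\<close> show ?thesis by (simp add: face_def axis_def)
  next
    case False
    with * \<open>d = e\<close> have "\<bar>real_of_int (x $ i) - real_of_int (y $ i)\<bar> \<le> 1 / 2"
      by (simp add: face_def axis_def)
    then show ?thesis by linarith
  qed
  ultimately show ?thesis by (simp add: vec_eq_iff)
qed

lemma cube_Int_neighbour: "cube x \<inter> cube (x + axis d 1) \<subseteq> face x d"
proof
  fix z assume "z \<in> cube x \<inter> cube (x + axis d 1)"
  then have *: "\<bar>z $ i - real_of_int (x $ i)\<bar> \<le> 1 / 2"
    "\<bar>z $ i - real_of_int (x $ i + axis d 1 $ i)\<bar> \<le> 1 / 2" for i
    by (auto simp: cube_def)
  have "z $ d = real_of_int (x $ d) + 1 / 2"
    using *[of d] unfolding abs_le_iff axis_def by simp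
  with *(1) show "z \<in> face x d" by (simp add: face_def)
qed

lemma cube_eq_cbox: "cube x = cbox (\<chi> i. real_of_int (x $ i) - 1 / 2) (\<chi> i. real_of_int (x $ i) + 1 / 2)"
proof -
  have "\<bar>a - b\<bar> \<le> 1 / 2 \<longleftrightarrow> b - 1 / 2 \<le> a \<and> a \<le> b + 1 / 2" for a b :: real
    by linarith
  then show ?thesis
    unfolding cube_def set_eq_iff mem_box_cart mem_Collect_eq by simp
qed

text \<open>All points of the segment have integer coordinates off the direction \<open>d\<close>, and the only
  half-integer value along \<open>d\<close> is at the midpoint.\<close>

lemma closed_segment_Int_face:
  assumes "z \<in> closed_segment (pt x) (pt (x + axis d 1))" "z \<in> face y e"
  shows "x = y \<and> d = e"
proof -
  obtain t where t: "0 \<le> t" "t \<le> 1" and z: "z = (1 - t) *\<^sub>R pt x + t *\<^sub>R pt (x + axis d 1)"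
    using assms(1) by (auto simp: closed_segment_def)
  have zi: "z $ i = real_of_int (x $ i) + t * (if i = d then 1 else 0)" for i
    by (simp add: z axis_def algebra_simps)
  have "d = e"
  proof (rule ccontr)
    assume "d \<noteq> e"
    with assms(2) zi[of e] have "real_of_int (x $ e) = real_of_int (y $ e) + 1 / 2"
      by (simp add: face_def)
    then show False using half_integer by blast
  qed
  moreover have "x $ i = y $ i" for i
  proof (cases "i = d")
    case True
    with assms(2) \<open>d = e\<close> zi[of d] have "real_of_int (x $ i) + t = real_of_int (y $ i) + 1 / 2"
      by (simp add: face_def)
    with t show ?thesis by linarith
  next
    case False
    with assms(2) \<open>d = e\<close> have "\<bar>z $ i - real_of_int (y $ i)\<bar> \<le> 1 / 2"
      by (simp add: face_def)
    with zi[of i] False have "\<bar>real_of_int (x $ i) - real_of_int (y $ i)\<bar> \<le> 1 / 2"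
      by simp
    then show ?thesis by linarith
  qed
  ultimately show ?thesis by (simp add: vec_eq_iff)
qed

section \<open>Faces are the plaquettes\<close>

text \<open>The sides of a plaquette are parallel to the axes: a difference of two points of the shifted
  lattice is an integer vector, and its squared coordinates sum to one.\<close>

lemma shifted_unit_vector:
  assumes "a \<in> shifted_lattice" "a + u \<in> shifted_lattice" "norm u = 1"
  obtains d s where "u = s *\<^sub>R axis d 1" "s = 1 \<or> s = (-1 :: real)"
proof -
  obtain x y where x: "a = pt x + (\<chi> i. 1 / 2)" and y: "a + u = pt y + (\<chi> i. 1 / 2)"
    using assms(1,2) by (auto simp: shifted_lattice_def)
  have "u = (a + u) - a" by simp
  also have "\<dots> = pt (y - x)"
    unfolding y by (simp add: x vec_eq_iff)
  finally have u: "u = pt (y - x)" .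
  have "(\<Sum>i\<in>UNIV. (u $ i)\<^sup>2) = 1"
    using assms(3) by (simp add: norm_vec_def L2_set_def)
  then have "real_of_int (\<Sum>i\<in>UNIV. ((y - x) $ i)\<^sup>2) = 1"
    by (simp add: u)
  then have sq: "(\<Sum>i\<in>UNIV. ((y - x) $ i)\<^sup>2) = 1"
    by linarith
  have le1: "\<bar>(y - x) $ i\<bar> \<le> 1" for i
  proof -
    have "((y - x) $ i)\<^sup>2 \<le> (\<Sum>i\<in>UNIV. ((y - x) $ i)\<^sup>2)"
      by (rule member_le_sum) auto
    with sq show ?thesis
      using abs_square_le_1[of "(y - x) $ i"] by simp
  qed
  have "\<bar>(y - x) $ i\<bar> = ((y - x) $ i)\<^sup>2" for i
  proof -
    have "(y - x) $ i = 0 \<or> (y - x) $ i = 1 \<or> (y - x) $ i = -1"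
      using le1[of i] by linarith
    then show ?thesis by (elim disjE) simp_all
  qed
  with sq have "(\<Sum>i\<in>UNIV. \<bar>(y - x) $ i\<bar>) = 1" by simp
  then obtain d where "y - x = axis d 1 \<or> y - x = - axis d 1"
    unfolding unit_int_vector by blast
  moreover have "pt (axis d 1) = axis d 1" "pt (- axis d 1) = - axis d 1"
    by (auto simp: vec_eq_iff axis_def)
  ultimately show thesis
    using that[of 1 d] that[of "-1" d] u by auto
qed

lemma convex_hull_parallelogram:
  fixes a u v :: "'a :: real_vector"
  shows "convex hull {a, a + u, a + v, a + u + v} =
    {a + s *\<^sub>R u + t *\<^sub>R v | s t. 0 \<le> s \<and> s \<le> 1 \<and> 0 \<le> t \<and> t \<le> 1}" (is "_ = ?P")
proof
  have seg: "p + r *\<^sub>R w \<in> convex hull S" if "p \<in> convex hull S" "p + w \<in> convex hull S" "0 \<le> r" "r \<le> 1"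
    for p w :: 'a and r S
  proof -
    have "(1 - r) *\<^sub>R p + r *\<^sub>R (p + w) \<in> convex hull S"
      using that by (intro convexD) auto
    then show ?thesis by (simp add: algebra_simps)
  qed
  let ?S = "{a, a + u, a + v, a + u + v}"
  show "?P \<subseteq> convex hull ?S"
  proof
    fix z assume "z \<in> ?P"
    then obtain s t where st: "z = a + s *\<^sub>R u + t *\<^sub>R v" "0 \<le> s" "s \<le> 1" "0 \<le> t" "t \<le> 1" by blast
    have "a + s *\<^sub>R u \<in> convex hull ?S"
      using st by (intro seg) (auto intro: hull_inc)
    moreover have "a + s *\<^sub>R u + v \<in> convex hull ?S"
      using seg[of "a + v" ?S u s] st by (simp add: hull_inc add_ac)
    ultimately show "z \<in> convex hull ?S"
      unfolding st(1) using st(4,5) by (rule seg)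
  qed
  have "?P = (\<lambda>p. a + p) ` ((\<lambda>s. s *\<^sub>R u) ` {0..1} + (\<lambda>t. t *\<^sub>R v) ` {0..1})"
    by (auto simp: set_plus_def image_iff add.assoc Bex_def; blast)
  moreover have "convex ((\<lambda>s. s *\<^sub>R w) ` {0..1::real})" for w :: 'a
    by (intro convex_linear_image linearI) (auto simp: algebra_simps)
  ultimately have "convex ?P"
    by (simp only:) (intro convex_translation convex_set_plus)
  moreover have "?S \<subseteq> ?P"
  proof -
    have "a + s *\<^sub>R u + t *\<^sub>R v \<in> ?P" if "s \<in> {0,1}" "t \<in> {0,1}" for s t
      unfolding mem_Collect_eq using that by (intro exI[of _ s] exI[of _ t]) auto
    from this[of 0 0] this[of 0 1] this[of 1 0] this[of 1 1] show ?thesis by simp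
  qed
  ultimately show "convex hull ?S \<subseteq> ?P"
    by (rule hull_minimal[rotated])
qed

text \<open>A unit step from \<open>c\<close> in direction \<open>s\<close> sweeps an interval that is described by its midpoint, so
  the two signs need no separate treatment when faces are described by their middles.\<close>

lemma signed_unit_interval:
  fixes s b c :: real
  assumes "s = 1 \<or> s = -1"
  shows "(\<exists>t. 0 \<le> t \<and> t \<le> 1 \<and> b = c + t * s) \<longleftrightarrow> \<bar>b - (c + s / 2)\<bar> \<le> 1 / 2"
proof -
  have "(\<exists>t. 0 \<le> t \<and> t \<le> 1 \<and> b = c + t * s) \<longleftrightarrow> 0 \<le> (b - c) * s \<and> (b - c) * s \<le> 1"
    using assms by (elim disjE) (auto intro!: exI[of _ "(b - c) * s"])
  also have "\<dots> \<longleftrightarrow> \<bar>b - (c + s / 2)\<bar> \<le> 1 / 2"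
    using assms unfolding abs_le_iff by (elim disjE) (simp_all, linarith+)
  finally show ?thesis .
qed

lemma axis_square:
  fixes a :: "real ^ 3"
  assumes "i \<noteq> j" "d \<noteq> i" "d \<noteq> j" and s: "s = 1 \<or> s = -1" and t: "t = 1 \<or> t = -1"
  defines "u \<equiv> s *\<^sub>R axis i 1" and "v \<equiv> t *\<^sub>R axis j 1"
  defines "m \<equiv> a + (1 / 2) *\<^sub>R (u + v)"
  shows "convex hull {a, a + u, a + v, a + u + v} =
    {z. z $ d = m $ d \<and> (\<forall>k. k \<noteq> d \<longrightarrow> \<bar>z $ k - m $ k\<bar> \<le> 1 / 2)}"
proof -
  have all: "(\<forall>k. P k) \<longleftrightarrow> P d \<and> P i \<and> P j" for P
    using assms(1-3) by (metis other_index)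
  have m: "m $ d = a $ d" "m $ i = a $ i + s / 2" "m $ j = a $ j + t / 2"
    using assms(1-3) by (auto simp: m_def u_def v_def axis_def)
  have "z \<in> convex hull {a, a + u, a + v, a + u + v} \<longleftrightarrow>
    z $ d = a $ d \<and> (\<exists>r. 0 \<le> r \<and> r \<le> 1 \<and> z $ i = a $ i + r * s) \<and>
    (\<exists>r. 0 \<le> r \<and> r \<le> 1 \<and> z $ j = a $ j + r * t)" for z
    unfolding convex_hull_parallelogram
    using assms(1-3) by (auto simp: vec_eq_iff all u_def v_def axis_def)
  then show ?thesis
    using assms(1-3) unfolding signed_unit_interval[OF s] signed_unit_interval[OF t]
    by (auto simp: all m)
qed

lemma face_eq_midpoint_box:
  assumes "m = pt x + (1 / 2) *\<^sub>R axis d 1"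
  shows "face x d = {z. z $ d = m $ d \<and> (\<forall>k. k \<noteq> d \<longrightarrow> \<bar>z $ k - m $ k\<bar> \<le> 1 / 2)}"
  by (auto simp: face_def assms axis_def)

text \<open>The side vectors of a plaquette lie along two different axes; the remaining axis is the normal
  direction \<open>d\<close>, and the middle determines the vertex \<open>x\<close>.\<close>

lemma plaquette_with_middle_iff:
  "plaquette_with_middle h m \<longleftrightarrow> (\<exists>x d. h = face x d \<and> m = pt x + (1 / 2) *\<^sub>R axis d 1)"
proof
  assume "plaquette_with_middle h m"
  then obtain a u v where n: "norm u = 1" "norm v = 1" "u \<bullet> v = 0"
    and sh: "a \<in> shifted_lattice" "a + u \<in> shifted_lattice" "a + v \<in> shifted_lattice"
    and h: "h = convex hull {a, a + u, a + v, a + u + v}"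
    and m: "m = a + (1 / 2) *\<^sub>R (u + v)"
    by (auto simp: plaquette_with_middle_def)
  obtain i s where u: "u = s *\<^sub>R axis i 1" and s: "s = 1 \<or> s = (-1 :: real)"
    using shifted_unit_vector[OF sh(1,2) n(1)] by metis
  obtain j t where v: "v = t *\<^sub>R axis j 1" and t: "t = 1 \<or> t = (-1 :: real)"
    using shifted_unit_vector[OF sh(1,3) n(2)] by metis
  have "i \<noteq> j"
    using n(3) s t by (auto simp: u v inner_axis_axis)
  then obtain d where d: "d \<noteq> i" "d \<noteq> j" "\<And>l. l = i \<or> l = j \<or> l = d"
    by (metis other_index)
  obtain c where c: "a = pt c + (\<chi> i. 1 / 2)"
    using sh(1) by (auto simp: shifted_lattice_def)
  (* the corner a has coordinates c + 1/2, and a positive side raises the midpoint coordinate to c + 1 *)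
  define x where "x = c + (if s = 1 then axis i 1 else 0) + (if t = 1 then axis j 1 else 0)"
  have "m $ k = (pt x + (1 / 2) *\<^sub>R axis d 1) $ k" for k
    using d(3)[of k] \<open>i \<noteq> j\<close> d(1,2) s t
    by (elim disjE) (simp_all add: m u v c x_def axis_def)
  then have mx: "m = pt x + (1 / 2) *\<^sub>R axis d 1" by (simp add: vec_eq_iff)
  have "h = face x d"
    unfolding face_eq_midpoint_box[OF mx] unfolding h m u v
    using \<open>i \<noteq> j\<close> d(1,2) s t by (rule axis_square)
  with mx show "\<exists>x d. h = face x d \<and> m = pt x + (1 / 2) *\<^sub>R axis d 1" by blast
next
  assume "\<exists>x d. h = face x d \<and> m = pt x + (1 / 2) *\<^sub>R axis d 1"
  then obtain x d where h: "h = face x d" and m: "m = pt x + (1 / 2) *\<^sub>R axis d 1" by blast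
  obtain i where "i \<noteq> d" using that[of "d + 1"] by simp
  then obtain j where j: "j \<noteq> i" "j \<noteq> d" "\<And>l. l = i \<or> l = d \<or> l = j"
    by (metis other_index)
  define c where "c = x - axis i 1 - axis j 1"
  define a where "a = pt c + (\<chi> i. 1 / 2)"
  have sh: "pt y + (\<chi> i. 1 / 2) \<in> shifted_lattice" for y
    by (auto simp: shifted_lattice_def)
  then have "a \<in> shifted_lattice" by (simp add: a_def)
  have eq: "a + axis i 1 = pt (c + axis i 1) + (\<chi> i. 1 / 2)"
    "a + axis j 1 = pt (c + axis j 1) + (\<chi> i. 1 / 2)"
    "a + axis i 1 + axis j 1 = pt (c + axis i 1 + axis j 1) + (\<chi> i. 1 / 2)"
    by (auto simp: vec_eq_iff a_def axis_def)
  have corners: "{a, a + axis i 1, a + axis j 1, a + axis i 1 + axis j 1} \<subseteq> shifted_lattice"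
    using \<open>a \<in> shifted_lattice\<close> sh[of "c + axis i 1", folded eq(1)] sh[of "c + axis j 1", folded eq(2)]
      sh[of "c + axis i 1 + axis j 1", folded eq(3)] by blast
  have "m $ k = (a + (1 / 2) *\<^sub>R (axis i 1 + axis j 1)) $ k" for k
    using j(3)[of k] \<open>i \<noteq> d\<close> j(1,2) by (elim disjE) (simp_all add: m a_def c_def axis_def)
  then have ma: "m = a + (1 / 2) *\<^sub>R (axis i 1 + axis j 1)" by (simp add: vec_eq_iff)
  have "h = convex hull {a, a + axis i 1, a + axis j 1, a + axis i 1 + axis j 1}"
    unfolding h face_eq_midpoint_box[OF m]
    using axis_square[of i j d 1 1 a] \<open>i \<noteq> d\<close> j(1,2) by (simp add: ma)
  with corners ma j(1) show "plaquette_with_middle h m"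
    unfolding plaquette_with_middle_def
    by (intro exI[of _ a] exI[of _ "axis i 1"] exI[of _ "axis j 1"]) (simp add: inner_axis_axis)
qed

lemma face_in_plaquettes: "face x d \<in> plaquettes"
  by (auto simp: plaquettes_def plaquette_with_middle_iff)

lemma dual_plaquette_eq_face: "dual_plaquette {x, x + axis d 1} = face x d"
  unfolding dual_plaquette_def
proof (rule the_equality)
  have "pt x + (1 / 2) *\<^sub>R axis d 1 = midpoint (pt x) (pt (x + axis d 1))"
    by (auto simp: vec_eq_iff midpoint_def axis_def)
  then have "pt x + (1 / 2) *\<^sub>R axis d 1 \<in> convex hull (pt ` {x, x + axis d 1})"
    by (simp add: flip: segment_convex_hull)
  then show "\<exists>m. plaquette_with_middle (face x d) m \<and> m \<in> convex hull (pt ` {x, x + axis d 1})"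
    unfolding plaquette_with_middle_iff by blast
next
  fix h assume "\<exists>m. plaquette_with_middle h m \<and> m \<in> convex hull (pt ` {x, x + axis d 1})"
  then obtain y e where h: "h = face y e"
    and m: "pt y + (1 / 2) *\<^sub>R axis e 1 \<in> closed_segment (pt x) (pt (x + axis d 1))"
    unfolding plaquette_with_middle_iff by (auto simp: segment_convex_hull)
  from closed_segment_Int_face[OF m face_center] h show "h = face x d" by simp
qed

section \<open>Faces around a common unit segment\<close>

definition square_edges :: "vertex \<Rightarrow> 3 \<Rightarrow> 3 \<Rightarrow> (vertex \<times> 3) set" where
  "square_edges x i j = {(x, i), (x, j), (x + axis i 1, j), (x + axis j 1, i)}"

text \<open>The four plaquettes dual to the edges of a lattice square are arranged like the pages of a book
  around the unit segment \<open>s\<close> that crosses the middle of the square at right angles.\<close>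

lemma square_edges_adj:
  assumes "i \<noteq> j" "(y, d) \<in> square_edges x i j" "(z, e) \<in> square_edges x i j" "(y, d) \<noteq> (z, e)"
  shows "plaquette_adj (face y d) (face z e)"
proof -
  obtain k where k: "k \<noteq> i" "k \<noteq> j" "\<And>l. l = i \<or> l = j \<or> l = k"
    using other_index[OF assms(1)] by blast
  have all: "(\<forall>l. P l) \<longleftrightarrow> P i \<and> P j \<and> P k" for P
  proof safe
    fix l assume "P i" "P j" "P k"
    then show "P l" using k(3)[of l] by auto
  qed auto
  define s where "s = {w :: real ^ 3. w $ i = real_of_int (x $ i) + 1 / 2 \<and>
    w $ j = real_of_int (x $ j) + 1 / 2 \<and>
    real_of_int (x $ k) - 1 / 2 \<le> w $ k \<and> w $ k \<le> real_of_int (x $ k) + 1 / 2}"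
  let ?near = "\<lambda>w l. real_of_int (x $ l) - 1 / 2 \<le> w $ l \<and> w $ l \<le> real_of_int (x $ l) + 1 / 2"
  let ?beyond = "\<lambda>w l. real_of_int (x $ l) + 1 / 2 \<le> w $ l \<and> w $ l \<le> real_of_int (x $ l) + 3 / 2"
  have mem: "w \<in> face x i \<longleftrightarrow> w $ i = real_of_int (x $ i) + 1 / 2 \<and> ?near w j \<and> ?near w k"
    "w \<in> face x j \<longleftrightarrow> w $ j = real_of_int (x $ j) + 1 / 2 \<and> ?near w i \<and> ?near w k"
    "w \<in> face (x + axis i 1) j \<longleftrightarrow> w $ j = real_of_int (x $ j) + 1 / 2 \<and> ?beyond w i \<and> ?near w k"
    "w \<in> face (x + axis j 1) i \<longleftrightarrow> w $ i = real_of_int (x $ i) + 1 / 2 \<and> ?beyond w j \<and> ?near w k" for w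
    unfolding mem_face_iff all using assms(1) k(1,2) by (auto simp: axis_def)
  have "face x i \<inter> face x j = s" "face x i \<inter> face (x + axis i 1) j = s"
    "face x i \<inter> face (x + axis j 1) i = s" "face x j \<inter> face (x + axis i 1) j = s"
    "face x j \<inter> face (x + axis j 1) i = s" "face (x + axis i 1) j \<inter> face (x + axis j 1) i = s"
    unfolding set_eq_iff Int_iff mem s_def mem_Collect_eq by (intro allI; linarith)+
  then have int: "face y d \<inter> face z e = s"
    using assms(2-4) unfolding square_edges_def insert_iff empty_iff prod.inject
    by (elim disjE) (simp_all add: Int_commute)
  define a :: "real ^ 3" where "a = (\<chi> l. if l = k then real_of_int (x $ k) - 1 / 2 else real_of_int (x $ l) + 1 / 2)"
  have "s = closed_segment a (a + axis k 1)"
  proof -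
    have "w \<in> s \<longleftrightarrow> (\<exists>t. 0 \<le> t \<and> t \<le> 1 \<and> w = a + t *\<^sub>R axis k 1)" for w
    proof
      assume "w \<in> s"
      then have "w = a + (w $ k - a $ k) *\<^sub>R axis k 1" "0 \<le> w $ k - a $ k" "w $ k - a $ k \<le> 1"
        using k(1,2) by (auto simp: s_def a_def vec_eq_iff all axis_def abs_le_iff)
      then show "\<exists>t. 0 \<le> t \<and> t \<le> 1 \<and> w = a + t *\<^sub>R axis k 1" by blast
    next
      assume "\<exists>t. 0 \<le> t \<and> t \<le> 1 \<and> w = a + t *\<^sub>R axis k 1"
      then show "w \<in> s"
        using k(1,2) by (auto simp: s_def a_def axis_def abs_le_iff)
    qed
    then show ?thesis
      by (auto simp: closed_segment_def algebra_simps)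
  qed
  moreover have "closed_segment a (a + axis k 1) homeomorphic {0..1::real}"
    using homeomorphic_arc_image_interval[of "linepath a (a + axis k 1)" 0 1] arc_linepath[of a "a + axis k 1"]
    by (simp add: axis_eq_0_iff)
  moreover have "face y d \<noteq> face z e"
    using face_inj assms(4) by blast
  ultimately show ?thesis
    by (simp add: plaquette_adj_def int)
qed

section \<open>The boundary of a connected set with connected complement is 1-connected\<close>

lemma connected_vertices_iff_linked:
  "connected_vertices S \<longleftrightarrow> S \<noteq> {} \<and> (\<forall>x\<in>S. \<forall>y\<in>S. linked S adj x y)"
  by (simp add: connected_vertices_def connected_graph_iff_linked)

lemma linked_UNIV: "linked UNIV adj x y"
  by (rule linked_flat[where T = UNIV]) auto

lemma boundary_nonempty:
  assumes "A \<noteq> {}" "A \<noteq> UNIV"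
  shows "boundary A \<noteq> {}"
proof
  assume *: "boundary A = {}"
  have "(x \<in> A) = (x + axis d 1 \<in> A)" for x d
    using * unfolding boundary_def by blast
  then have "(a \<in> A) = (b \<in> A)" if "adj a b" for a b
    using that unfolding adj_iff by blast
  with linked_UNIV linked_const[where S = UNIV and R = adj and g = "\<lambda>x. x \<in> A"]
  have "(x \<in> A) = (y \<in> A)" for x y
    by blast
  with assms show False by blast
qed

text \<open>In the proof, \<open>D\<close> is the coboundary of the indicator function of \<open>A\<close>, the set \<open>L\<close> holds the
  edges whose plaquettes are reached from \<open>h\<close>, and \<open>f\<close> is the restriction of \<open>D\<close> to \<open>L\<close>. All
  edges of a square whose plaquettes are in the boundary are reached as soon as one is, which
  makes \<open>f\<close> closed and thus a coboundary of some \<open>g\<close>.\<close>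

lemma one_connected_boundary:
  assumes "connected_vertices A" "connected_vertices (- A)"
  shows "one_connected (boundary A)"
  unfolding one_connected_def connected_graph_iff_linked
proof (intro conjI ballI)
  show "boundary A \<noteq> {}"
    using assms by (intro boundary_nonempty) (auto simp: connected_vertices_iff_linked)
next
  fix h h' assume hh: "h \<in> boundary A" "h' \<in> boundary A"
  define L where "L = {(x, d). face x d \<in> boundary A \<and> linked (boundary A) plaquette_adj h (face x d)}"
  define D where "D x d = of_bool (x + axis d 1 \<in> A) - (of_bool (x \<in> A) :: int)" for x d
  define f where "f x d = (if (x, d) \<in> L then D x d else 0)" for x d
  have D0: "D x d = 0" if "face x d \<notin> boundary A" for x d
    using that unfolding D_def boundary_def by auto
  have D1: "D x d \<noteq> 0" if "face x d \<in> boundary A" for x d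
  proof -
    have "(x \<in> A) \<noteq> (x + axis d 1 \<in> A)"
      using that face_inj unfolding boundary_def by blast
    then show ?thesis by (auto simp: D_def)
  qed
  have closed: "f x i + f (x + axis i 1) j = f x j + f (x + axis j 1) i" if "i \<noteq> j" for x i j
  proof (cases "square_edges x i j \<inter> L = {}")
    case True
    then show ?thesis by (auto simp: f_def square_edges_def)
  next
    case False
    then obtain y d where yd: "(y, d) \<in> square_edges x i j" "(y, d) \<in> L" by auto
    have "f z e = D z e" if ze: "(z, e) \<in> square_edges x i j" for z e
    proof (cases "face z e \<in> boundary A \<and> (z, e) \<noteq> (y, d)")
      case True
      have "linked (boundary A) plaquette_adj h (face y d)"
        using yd by (simp add: L_def)
      also have "linked (boundary A) plaquette_adj (face y d) (face z e)"
        using True yd(2) square_edges_adj[OF \<open>i \<noteq> j\<close> yd(1) ze]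
        by (intro linked_step) (auto simp: L_def)
      finally show ?thesis
        using True by (simp add: f_def L_def)
    next
      case False
      then show ?thesis using yd D0 by (auto simp: f_def)
    qed
    then have "f x i = D x i" "f (x + axis i 1) j = D (x + axis i 1) j"
      "f x j = D x j" "f (x + axis j 1) i = D (x + axis j 1) i"
      by (simp_all add: square_edges_def)
    then show ?thesis by (simp add: D_def add_ac)
  qed
  obtain g where g: "\<And>x i. g (x + axis i 1) - g x = f x i"
    by (rule discrete_poincare[of f]) (use closed in auto)
  have g_const: "g x = g y" if "S = A \<or> S = - A" "x \<in> S" "y \<in> S" for S x y
  proof (rule linked_const[where g = g])
    show "linked S adj x y"
      using assms that by (auto simp: connected_vertices_iff_linked)
  next
    fix a b assume ab: "a \<in> S" "b \<in> S" "adj a b"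
    have "f c d = 0" if "c \<in> S" "c + axis d 1 \<in> S" for c d
      using that \<open>S = A \<or> S = - A\<close> by (auto simp: f_def D_def)
    with ab g show "g a = g b"
      unfolding adj_iff by (metis eq_iff_diff_eq_0)
  qed
  obtain a b where ab: "a \<in> A" "b \<notin> A"
    using assms by (auto simp: connected_vertices_iff_linked)
  (* g is constant on A and on - A, so f is the multiple of D by the difference of the two values *)
  have jump: "f x d = (g b - g a) * - D x d" if "face x d \<in> boundary A" for x d
  proof -
    have "(x \<in> A) \<noteq> (x + axis d 1 \<in> A)"
      using D1[OF that] by (auto simp: D_def)
    then consider "x \<in> A" "x + axis d 1 \<notin> A" | "x \<notin> A" "x + axis d 1 \<in> A" by blast
    then show ?thesis
    proof cases
      case 1
      then have "g x = g a" "g (x + axis d 1) = g b"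
        using ab by (auto intro: g_const[of A] g_const[of "- A"])
      with 1 show ?thesis using g[of x d] by (simp add: D_def)
    next
      case 2
      then have "g x = g b" "g (x + axis d 1) = g a"
        using ab by (auto intro: g_const[of A] g_const[of "- A"])
      with 2 show ?thesis using g[of x d] by (simp add: D_def)
    qed
  qed
  obtain x d where xd: "h = face x d" using hh(1) by (auto simp: boundary_def)
  have "(x, d) \<in> L" using hh(1) by (simp add: L_def xd)
  then have "g b - g a \<noteq> 0"
    using jump[of x d] D1[of x d] hh(1) by (auto simp: f_def xd)
  obtain x' d' where xd': "h' = face x' d'" using hh(2) by (auto simp: boundary_def)
  have "f x' d' \<noteq> 0"
    using jump[of x' d'] D1[of x' d'] hh(2) \<open>g b - g a \<noteq> 0\<close> by (simp add: xd')
  then have "(x', d') \<in> L" by (simp add: f_def split: if_splits)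
  then show "linked (boundary A) plaquette_adj h h'" by (simp add: L_def xd')
qed

section \<open>The boundary separates\<close>

lemma pt_notin_boundary: "pt x \<notin> \<Union>(boundary A)"
  using pt_notin_face by (auto simp: boundary_def)

text \<open>The cubes about \<open>a\<close> and \<open>b\<close> may share just an edge or a corner. Changing the coordinates of \<open>a\<close>
  into those of \<open>b\<close> one at a time gives a lattice walk, and all cubes along it contain \<open>z\<close> because
  cubes are products of intervals. Somewhere the walk leaves \<open>A\<close>, and it does so through a face
  that contains \<open>z\<close>.\<close>

lemma cube_Int_cube_boundary:
  assumes "a \<in> A" "b \<notin> A" "z \<in> cube a" "z \<in> cube b"
  shows "z \<in> \<Union>(boundary A)"
proof (rule ccontr)
  assume z: "z \<notin> \<Union>(boundary A)"
  have cross: "x + axis d 1 \<in> A \<longleftrightarrow> x \<in> A" if "z \<in> cube x" "z \<in> cube (x + axis d 1)" for x d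
    using that z cube_Int_neighbour[of x d] by (auto simp: boundary_def)
  define c where "c T = (\<chi> i. if i \<in> T then b $ i else a $ i)" for T
  have zc: "z \<in> cube (c T)" for T
    using assms(3,4) by (auto simp: cube_def c_def)
  have "c T \<in> A" if "finite T" for T
    using that
  proof (induction T rule: finite_induct)
    case empty
    have "c {} = a" by (simp add: c_def vec_eq_iff)
    with assms show ?case by simp
  next
    case (insert j T)
    have "\<bar>z $ j - real_of_int (a $ j)\<bar> \<le> 1 / 2" "\<bar>z $ j - real_of_int (b $ j)\<bar> \<le> 1 / 2"
      using assms(3,4) unfolding cube_def by blast+
    then have "\<bar>a $ j - b $ j\<bar> \<le> 1" by linarith
    then consider "b $ j = a $ j" | "b $ j = a $ j + 1" | "a $ j = b $ j + 1" by linarith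
    then show ?case
    proof cases
      case 1
      then have "c (insert j T) = c T" by (auto simp: c_def vec_eq_iff)
      with insert show ?thesis by simp
    next
      case 2
      then have "c (insert j T) = c T + axis j 1"
        using insert by (auto simp: c_def vec_eq_iff axis_def)
      with insert cross[of "c T" j] zc show ?thesis by metis
    next
      case 3
      then have "c T = c (insert j T) + axis j 1"
        using insert by (auto simp: c_def vec_eq_iff axis_def)
      with insert cross[of "c (insert j T)" j] zc show ?thesis by metis
    qed
  qed
  then have "c UNIV \<in> A" by simp
  moreover have "c UNIV = b" by (simp add: c_def vec_eq_iff)
  ultimately show False using assms by simp
qed

text \<open>A point on the frontier lies in a cube about a vertex of \<open>A\<close> and also in one about a vertex
  outside \<open>A\<close>. For the latter, only the finitely many cubes near the point matter, so that
  their union is closed.\<close>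

lemma frontier_cubes_subset_boundary:
  assumes "finite A"
  shows "frontier (\<Union>(cube ` A)) \<subseteq> \<Union>(boundary A)"
proof
  let ?K = "\<Union>(cube ` A)"
  fix z assume z: "z \<in> frontier ?K"
  have "closed ?K"
    using assms by (auto simp: cube_eq_cbox)
  with z have "z \<in> ?K"
    using frontier_subset_closed by blast
  then obtain a where a: "a \<in> A" "z \<in> cube a" by blast
  (* contains every vertex outside A whose cube meets the open box ?B of radius 1 about z *)
  define N where "N = - A \<inter> {b. \<forall>i. b $ i \<in> {\<lfloor>z $ i\<rfloor> - 2..\<lceil>z $ i\<rceil> + 2}}"
  let ?L = "\<Union>(cube ` N)"
  let ?B = "box (\<chi> i. z $ i - 1) (\<chi> i. z $ i + 1)"
  have "finite N" unfolding N_def by (intro finite_Int disjI2 finite_int_box)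
  then have "closed ?L" by (auto simp: cube_eq_cbox)
  have "z \<in> ?L"
  proof (rule ccontr)
    assume "z \<notin> ?L"
    have "?B - ?L \<subseteq> ?K"
    proof
      fix y assume y: "y \<in> ?B - ?L"
      define b :: vertex where "b = (\<chi> i. round (y $ i))"
      have "\<bar>y $ i - real_of_int (b $ i)\<bar> \<le> 1 / 2" for i
        using of_int_round_abs_le[of "y $ i"] by (simp add: b_def abs_minus_commute)
      then have yb: "y \<in> cube b" unfolding cube_def by blast
      have "b $ i \<in> {\<lfloor>z $ i\<rfloor> - 2..\<lceil>z $ i\<rceil> + 2}" for i
      proof -
        have "\<bar>y $ i - real_of_int (b $ i)\<bar> \<le> 1 / 2"
          using yb unfolding cube_def by blast
        moreover have "z $ i - 1 < y $ i" "y $ i < z $ i + 1"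
          using y by (auto simp: mem_box_cart)
        ultimately have "\<lfloor>z $ i\<rfloor> - 2 \<le> b $ i" "b $ i \<le> \<lceil>z $ i\<rceil> + 2"
          by linarith+
        then show ?thesis by simp
      qed
      with y yb have "b \<in> A" unfolding N_def by blast
      with yb show "y \<in> ?K" by blast
    qed
    moreover have "open (?B - ?L)"
      using \<open>closed ?L\<close> by (intro open_Diff open_box)
    moreover have "z \<in> ?B - ?L"
      using \<open>z \<notin> ?L\<close> by (simp add: mem_box_cart)
    ultimately have "z \<in> interior ?K" by (meson interiorI)
    with z show False by (simp add: frontier_def)
  qed
  then obtain b where "b \<notin> A" "z \<in> cube b" unfolding N_def by blast
  with a show "z \<in> \<Union>(boundary A)" by (intro cube_Int_cube_boundary)
qed

lemma pt_inside_boundary: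
  assumes "finite A" "x \<in> A"
  shows "pt x \<in> inside (\<Union>(boundary A))"
proof -
  let ?K = "\<Union>(cube ` A)" and ?C = "connected_component_set (- \<Union>(boundary A)) (pt x)"
  have "pt x \<in> ?C"
    using pt_notin_boundary by simp
  moreover have "pt x \<in> ?K"
    using assms(2) by (force simp: cube_def)
  moreover have "?C \<inter> frontier ?K = {}"
    using frontier_cubes_subset_boundary[OF assms(1)] connected_component_subset[of "- \<Union>(boundary A)" "pt x"]
    by blast
  ultimately have "?C \<subseteq> ?K"
    using connected_Int_frontier[of ?C ?K] connected_connected_component by blast
  moreover have "bounded ?K"
    using assms(1) by (auto simp: cube_eq_cbox bounded_cbox)
  ultimately have "bounded ?C"
    by (rule bounded_subset[rotated])
  then show ?thesis
    using pt_notin_boundary by (simp add: inside_def)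
qed

lemma unbounded_pt_image:
  assumes "infinite U"
  shows "\<not> bounded (pt ` U)"
proof
  assume "bounded (pt ` U)"
  then obtain B where B: "\<And>x. x \<in> U \<Longrightarrow> norm (pt x) \<le> B"
    by (auto simp: bounded_iff)
  have "U \<subseteq> {x. \<forall>i. x $ i \<in> {- \<lceil>B\<rceil>..\<lceil>B\<rceil>}}"
  proof safe
    fix x i assume "x \<in> U"
    then have "\<bar>pt x $ i\<bar> \<le> B"
      using B component_le_norm_cart[of "pt x" i] by fastforce
    then have "- \<lceil>B\<rceil> \<le> x $ i" "x $ i \<le> \<lceil>B\<rceil>"
      unfolding pt_nth by linarith+
    then show "x $ i \<in> {- \<lceil>B\<rceil>..\<lceil>B\<rceil>}" by simp
  qed
  then have "finite U" by (rule finite_subset[OF _ finite_int_box])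
  with assms show False by simp
qed

lemma pt_outside_boundary:
  assumes "connected_vertices U" "infinite U" "U \<inter> A = {}" "x \<in> U"
  shows "pt x \<in> outside (\<Union>(boundary A))"
proof -
  let ?Q = "- \<Union>(boundary A)"
  have edge: "connected_component ?Q (pt a) (pt b)" if "a \<in> U" "b \<in> U" "adj a b" for a b
  proof -
    have *: "connected_component ?Q (pt c) (pt (c + axis d 1))" if "c \<in> U" "c + axis d 1 \<in> U" for c d
    proof -
      have "closed_segment (pt c) (pt (c + axis d 1)) \<subseteq> ?Q"
      proof safe
        fix z h assume z: "z \<in> closed_segment (pt c) (pt (c + axis d 1))" "h \<in> boundary A" "z \<in> h"
        then obtain y e where "h = face y e" "(y \<in> A) \<noteq> (y + axis e 1 \<in> A)"
          by (auto simp: boundary_def)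
        moreover from this z have "c = y \<and> d = e"
          by (intro closed_segment_Int_face) auto
        ultimately show False using that assms(3) by blast
      qed
      then show ?thesis
        unfolding connected_component_def by (intro exI conjI) auto
    qed
    with that show ?thesis
      unfolding adj_iff using connected_component_sym by blast
  qed
  have "connected_component_set ?Q (pt x) = connected_component_set ?Q (pt y)" if "y \<in> U" for y
  proof (rule linked_const[where g = "\<lambda>y. connected_component_set ?Q (pt y)"])
    show "linked U adj x y"
      using assms that by (simp add: connected_vertices_iff_linked)
    show "connected_component_set ?Q (pt a) = connected_component_set ?Q (pt b)"
      if "a \<in> U" "b \<in> U" "adj a b" for a b
      using connected_component_eq[of "pt b" ?Q "pt a"] edge[OF that] by simp
  qed
  then have "pt ` U \<subseteq> connected_component_set ?Q (pt x)"
    using pt_notin_boundary by fastforce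
  then have "\<not> bounded (connected_component_set ?Q (pt x))"
    using unbounded_pt_image[OF assms(2)] bounded_subset by blast
  then show ?thesis
    using pt_notin_boundary by (simp add: outside)
qed

section \<open>Filling in the holes\<close>

lemma finite_boundary:
  assumes "finite A"
  shows "finite (boundary A)"
proof -
  have "boundary A \<subseteq> (\<lambda>(x, d). face x d) ` ((A \<union> (\<Union>d. (\<lambda>x. x - axis d 1) ` A)) \<times> UNIV)"
  proof
    fix h assume "h \<in> boundary A"
    then obtain x d where h: "h = face x d" and "(x \<in> A) \<noteq> (x + axis d 1 \<in> A)"
      by (auto simp: boundary_def)
    then have "x \<in> A \<or> x \<in> (\<lambda>x. x - axis d 1) ` A"
      by (cases "x \<in> A") (auto intro!: image_eqI[of _ _ "x + axis d 1"])
    then have "(x, d) \<in> (A \<union> (\<Union>d. (\<lambda>x. x - axis d 1) ` A)) \<times> UNIV"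
      by blast
    then show "h \<in> (\<lambda>(x, d). face x d) ` ((A \<union> (\<Union>d. (\<lambda>x. x - axis d 1) ` A)) \<times> UNIV)"
      unfolding h by (rule rev_image_eqI) simp
  qed
  then show ?thesis
    by (rule finite_subset) (use assms in auto)
qed

theorem proposition5:
  fixes V :: "vertex set" and E :: "vertex set set"
  assumes "lattice_subgraph V E"
    and "finite V"
    and "connected_graph V (\<lambda>x y. {x, y} \<in> E)"
  shows "\<exists>Q. splitting_set Q \<and>
    pt ` V \<subseteq> inside (\<Union>Q) \<and>
    (\<forall>h\<in>Q. \<exists>e\<in>lattice_edges. card (e \<inter> V) = 1 \<and> h = dual_plaquette e) \<and>
    (\<forall>W. connected_vertices W \<and> V \<inter> W = {} \<and>
         (\<exists>p. infinite_lattice_path p \<and> p 0 \<in> W \<and> (\<forall>n. p n \<notin> V))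
       \<longrightarrow> pt ` W \<subseteq> outside (\<Union>Q))"
proof -
  have V: "V \<noteq> {}" "E \<subseteq> lattice_edges"
    using assms(1) by (auto simp: lattice_subgraph_def)
  have V_linked: "linked V adj x y" if "x \<in> V" "y \<in> V" for x y
    using assms(3) that V(2) unfolding connected_graph_iff_linked
    by (blast intro: linked_mono)
  (* a cube around V; the corner just outside it represents the infinite component *)
  obtain N :: int where N: "\<And>x i. x \<in> V \<Longrightarrow> \<bar>x $ i\<bar> \<le> N" "N \<ge> 0"
  proof
    define N where "N = (\<Sum>x\<in>V. \<Sum>i\<in>UNIV. \<bar>x $ i\<bar>)"
    show "\<bar>x $ i\<bar> \<le> N" if "x \<in> V" for x i
    proof -
      have "\<bar>x $ i\<bar> \<le> (\<Sum>i\<in>UNIV. \<bar>x $ i\<bar>)"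
        by (rule member_le_sum) auto
      also have "\<dots> \<le> N"
        unfolding N_def using that assms(2)
        by (intro member_le_sum[where f = "\<lambda>x. \<Sum>i\<in>UNIV. \<bar>x $ i\<bar>"]) (auto intro: sum_nonneg)
      finally show ?thesis .
    qed
    show "N \<ge> 0" unfolding N_def by (intro sum_nonneg) auto
  qed
  define corner :: vertex where "corner = (\<chi> k. N + 1)"
  (* the vertices of V are removed explicitly, because linked is reflexive everywhere *)
  define U where "U = {x. linked (- V) adj x corner} - V"
  have far: "linked (- V) adj x corner" if "\<bar>x $ i\<bar> > N" for x i
    unfolding corner_def
  proof (rule linked_far)
    show "y \<in> - V" if "\<bar>y $ i\<bar> > N" for y i
      using N(1)[of y i] that by force
  qed (use that N in auto)
  have far_U: "x \<in> U" if "\<bar>x $ i\<bar> > N" for x i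
    using far[OF that] N(1)[of x i] that unfolding U_def by force
  have corner_in_U: "corner \<in> U"
    using N(2) by (intro far_U[of _ 1]) (simp add: corner_def)
  have U_step: "a \<in> U" if "adj a b" "a \<notin> V" "b \<in> U" for a b
    using that linked_step[of a "- V" b adj] linked_trans[of "- V" adj a b corner] by (auto simp: U_def)
  have to_corner: "linked U adj x corner" if "x \<in> U" for x
  proof -
    have "linked (- V) adj x corner" using that by (simp add: U_def)
    then have "x \<in> U \<and> linked U adj x corner"
      unfolding linked_def[of "- V"]
    proof (induction rule: converse_rtranclp_induct)
      case (step a b)
      then have "a \<in> U" using U_step[of a b] by blast
      then show ?case
        using step linked_step[of a U b adj] linked_trans[of U adj a b corner] by blast
    qed (simp add: corner_in_U)
    then show ?thesis ..
  qed
  have U_conn: "connected_vertices U"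
    unfolding connected_vertices_iff_linked
    using corner_in_U to_corner by (blast intro: linked_trans linked_sym adj_sym)
  define A where "A = - U"
  have "V \<subseteq> A" by (auto simp: A_def U_def)
  have "A \<subseteq> {x. \<forall>i. x $ i \<in> {- N..N}}"
  proof safe
    fix x i assume "x \<in> A"
    then have "\<not> \<bar>x $ i\<bar> > N" using far_U[of x i] by (auto simp: A_def)
    then show "x $ i \<in> {- N..N}" unfolding atLeastAtMost_iff by linarith
  qed
  then have "finite A" by (rule finite_subset[OF _ finite_int_box])
  have "infinite U"
  proof
    assume "finite U"
    define q :: "nat \<Rightarrow> vertex" where "q n = (\<chi> k. N + 1 + int n)" for n
    have "q n \<in> U" for n
      using N(2) by (intro far_U[of _ 1]) (simp add: q_def)
    then have "range q \<subseteq> U" by blast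
    then have "finite (range q)"
      using \<open>finite U\<close> by (rule finite_subset)
    moreover have "inj q"
      by (auto simp: inj_def q_def vec_eq_iff)
    ultimately show False
      using finite_imageD infinite_UNIV_nat by blast
  qed
  have inner: "a \<in> V" if "a \<in> A" "b \<notin> A" "adj a b" for a b
    using U_step[OF that(3)] that by (auto simp: A_def)
  obtain v where v: "v \<in> V" using V(1) by blast
  (* a walk from a vertex of A towards V stays in A until it first enters V *)
  have to_V: "\<exists>w\<in>V. linked A adj x w" if "x \<in> A" for x
  proof -
    have "x \<in> A \<longrightarrow> (\<exists>w\<in>V. linked A adj x w)"
      using linked_UNIV[of x v] unfolding linked_def[of UNIV]
    proof (induction rule: converse_rtranclp_induct)
      case base
      then show ?case using v by (intro impI bexI[of _ v]) simp_all
    next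
      case (step a b)
      show ?case
      proof
        assume "a \<in> A"
        show "\<exists>w\<in>V. linked A adj a w"
        proof (cases "b \<in> A")
          case True
          then obtain w where "w \<in> V" "linked A adj b w" using step by blast
          moreover have "linked A adj a b"
            using step \<open>a \<in> A\<close> True by (intro linked_step) auto
          ultimately show ?thesis by (blast intro: linked_trans)
        next
          case False
          then have "a \<in> V" using step \<open>a \<in> A\<close> inner by blast
          then show ?thesis by (intro bexI[of _ a]) simp_all
        qed
      qed
    qed
    with that show ?thesis by blast
  qed
  have A_conn: "connected_vertices A"
    unfolding connected_vertices_iff_linked
  proof (intro conjI ballI)
    show "A \<noteq> {}" using v \<open>V \<subseteq> A\<close> by blast
    fix x y assume "x \<in> A" "y \<in> A"
    then obtain w w' where w: "w \<in> V" "linked A adj x w" "w' \<in> V" "linked A adj y w'"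
      using to_V by metis
    note w(2)
    also have "linked A adj w w'"
      using V_linked[OF w(1,3)] \<open>V \<subseteq> A\<close> by (rule linked_mono)
    also have "linked A adj w' y"
      using w(4) adj_sym by (rule linked_sym)
    finally show "linked A adj x y" .
  qed
  have inside: "pt ` V \<subseteq> inside (\<Union>(boundary A))"
    using pt_inside_boundary[OF \<open>finite A\<close>] \<open>V \<subseteq> A\<close> by blast
  have "splitting_set (boundary A)"
    unfolding splitting_set_def
  proof (intro conjI)
    show "finite (boundary A)" using \<open>finite A\<close> by (rule finite_boundary)
    show "boundary A \<subseteq> plaquettes" using face_in_plaquettes by (auto simp: boundary_def)
    show "one_connected (boundary A)"
      using A_conn U_conn by (intro one_connected_boundary) (simp_all add: A_def)
    show "\<exists>C\<in>components (- \<Union>(boundary A)). bounded C"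
      using inside v unfolding inside_eq_Union_bounded_components by blast
  qed
  moreover have "\<exists>e\<in>lattice_edges. card (e \<inter> V) = 1 \<and> h = dual_plaquette e" if "h \<in> boundary A" for h
  proof -
    obtain x d where h: "h = face x d" and "(x \<in> A) \<noteq> (x + axis d 1 \<in> A)"
      using \<open>h \<in> boundary A\<close> unfolding boundary_def by blast
    then consider "x \<in> A" "x + axis d 1 \<notin> A" | "x + axis d 1 \<in> A" "x \<notin> A" by blast
    then have "\<exists>y. {x, x + axis d 1} \<inter> V = {y}"
    proof cases
      case 1
      then have "{x, x + axis d 1} \<inter> V = {x}"
        using inner[OF _ _ adj_axis] \<open>V \<subseteq> A\<close> by blast
      then show ?thesis ..
    next
      case 2
      then have "{x, x + axis d 1} \<inter> V = {x + axis d 1}"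
        using inner[OF _ _ adj_sym[OF adj_axis]] \<open>V \<subseteq> A\<close> by blast
      then show ?thesis ..
    qed
    then have "card ({x, x + axis d 1} \<inter> V) = 1" by (metis is_singletonI is_singleton_altdef)
    then show ?thesis
      by (intro bexI[of _ "{x, x + axis d 1}"] conjI) (simp_all add: h dual_plaquette_eq_face)
  qed
  moreover have "pt ` W \<subseteq> outside (\<Union>(boundary A))"
    if W: "connected_vertices W" "V \<inter> W = {}"
      and p: "infinite_lattice_path p" "p 0 \<in> W" "\<And>n. p n \<notin> V" for W p
  proof -
    have p_linked: "linked (- V) adj (p 0) (p n)" for n
    proof (induction n)
      case (Suc n)
      have "linked (- V) adj (p n) (p (Suc n))"
        using p by (intro linked_step) (auto simp: infinite_lattice_path_def)
      with Suc show ?case by (rule linked_trans)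
    qed simp
    have "infinite (range p)"
      using p(1) by (simp add: infinite_lattice_path_def range_inj_infinite)
    moreover have "finite {x :: vertex. \<forall>i. x $ i \<in> {- N..N}}"
      by (rule finite_int_box)
    ultimately have "\<not> range p \<subseteq> {x. \<forall>i. x $ i \<in> {- N..N}}"
      using finite_subset by metis
    then obtain n i where "p n $ i \<notin> {- N..N}" by blast
    then have "\<bar>p n $ i\<bar> > N" unfolding atLeastAtMost_iff by linarith
    from linked_trans[OF p_linked far[OF this]] have p_far: "linked (- V) adj (p 0) corner" .
    have "W \<subseteq> U"
    proof
      fix w assume "w \<in> W"
      then have "linked W adj w (p 0)"
        using W(1) p(2) by (simp add: connected_vertices_iff_linked)
      then have "linked (- V) adj w (p 0)"
        by (rule linked_mono) (use W(2) in auto)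
      then have "linked (- V) adj w corner"
        using p_far by (rule linked_trans)
      with \<open>w \<in> W\<close> W(2) show "w \<in> U"
        unfolding U_def by blast
    qed
    moreover have "pt ` U \<subseteq> outside (\<Union>(boundary A))"
      using pt_outside_boundary[OF U_conn \<open>infinite U\<close>, of A] by (auto simp: A_def)
    ultimately show ?thesis by blast
  qed
  ultimately show ?thesis
    using inside by (intro exI[of _ "boundary A"]) blast
qed

end
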